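(* Let $P$ be a partially ordered set and $R$ a commutative unital ring. Each $R$-bilinear antisymmetric biderivation of $FI(P,R)$ defines a Poisson structure on $FI(P,R)$.
   Context: Let $(P,\le)$ be a poset and $R$ a commutative unital ring. $I(P,R)$ is the $R$-module of formal sums $f=\sum_{x\le y}f(x,y)e_{xy}$ with $f(x,y)\in R$, where $e_{xy}$ is a symbol attached to each pair $x\le y$ in $P$. Such $f$ is a finitary series if for every $x<y$ in $P$ there are only finitely many pairs $u,v\in P$ with $x\le u<v\le y$ and $f(u,v)\ne 0$. $FI(P,R)\subseteq I(P,R)$ is the set of finitary series; it is an associative unital $R$-algebra (the finitary incidence algebra of $P$ over $R$) under $(fg)(x,y)=\sum_{x\le z\le y}f(x,z)g(z,y)$. A biderivation of an associative ring $A$ is a biadditive map $B:A\times A\to A$ with $B(ab,c)=B(a,c)b+aB(b,c)$ and $B(a,bc)=B(a,b)c+bB(a,c)$ for all $a,b,c\in A$; it is antisymmetric if $B(a,a)=0$ for all $a\in A$. A Poisson structure on an associative $R$-algebra $A$ is an $R$-bilinear operation $\{\cdot,\cdot\}:A\times A\to A$ such that $(A,\{\cdot,\cdot\})$ is a Lie algebra and $\{a,bc\}=\{a,b\}c+b\{a,c\}$ for all $a,b,c\in A$. Equivalently, it is an $R$-bilinear antisymmetric biderivation of $A$ satisfying the Jacobi identity. *)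

theory Defs
  imports "HOL-Algebra.Module" "HOL-Algebra.Order"
begin

section \<open>Associative algebras, biderivations and Poisson structures\<close>

text \<open>
  The library locale for algebras over a commutative ring requires the algebra itself to be
  commutative, so the associative unital version is introduced here.
\<close>

locale assoc_algebra = module R A + ring A for R (structure) and A (structure) +
  assumes smult_mult_left:
      "\<lbrakk>r \<in> carrier R; a \<in> carrier A; b \<in> carrier A\<rbrakk> \<Longrightarrow>
        (r \<odot>\<^bsub>A\<^esub> a) \<otimes>\<^bsub>A\<^esub> b = r \<odot>\<^bsub>A\<^esub> (a \<otimes>\<^bsub>A\<^esub> b)"
    and smult_mult_right:
      "\<lbrakk>r \<in> carrier R; a \<in> carrier A; b \<in> carrier A\<rbrakk> \<Longrightarrow>
        a \<otimes>\<^bsub>A\<^esub> (r \<odot>\<^bsub>A\<^esub> b) = r \<odot>\<^bsub>A\<^esub> (a \<otimes>\<^bsub>A\<^esub> b)"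

definition biadditive_op :: "('a, 'm) ring_scheme \<Rightarrow> ('a \<Rightarrow> 'a \<Rightarrow> 'a) \<Rightarrow> bool"
  where "biadditive_op A B \<longleftrightarrow>
    (\<forall>a\<in>carrier A. \<forall>b\<in>carrier A. B a b \<in> carrier A) \<and>
    (\<forall>a\<in>carrier A. \<forall>b\<in>carrier A. \<forall>c\<in>carrier A. B (a \<oplus>\<^bsub>A\<^esub> b) c = B a c \<oplus>\<^bsub>A\<^esub> B b c) \<and>
    (\<forall>a\<in>carrier A. \<forall>b\<in>carrier A. \<forall>c\<in>carrier A. B a (b \<oplus>\<^bsub>A\<^esub> c) = B a b \<oplus>\<^bsub>A\<^esub> B a c)"

definition bilinear_op ::
    "('r, 'k) ring_scheme \<Rightarrow> ('r, 'a, 'm) module_scheme \<Rightarrow> ('a \<Rightarrow> 'a \<Rightarrow> 'a) \<Rightarrow> bool"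
  where "bilinear_op R A B \<longleftrightarrow> biadditive_op A B \<and>
    (\<forall>r\<in>carrier R. \<forall>a\<in>carrier A. \<forall>b\<in>carrier A. B (r \<odot>\<^bsub>A\<^esub> a) b = r \<odot>\<^bsub>A\<^esub> B a b) \<and>
    (\<forall>r\<in>carrier R. \<forall>a\<in>carrier A. \<forall>b\<in>carrier A. B a (r \<odot>\<^bsub>A\<^esub> b) = r \<odot>\<^bsub>A\<^esub> B a b)"

definition biderivation :: "('a, 'm) ring_scheme \<Rightarrow> ('a \<Rightarrow> 'a \<Rightarrow> 'a) \<Rightarrow> bool"
  where "biderivation A B \<longleftrightarrow> biadditive_op A B \<and>
    (\<forall>a\<in>carrier A. \<forall>b\<in>carrier A. \<forall>c\<in>carrier A.
      B (a \<otimes>\<^bsub>A\<^esub> b) c = B a c \<otimes>\<^bsub>A\<^esub> b \<oplus>\<^bsub>A\<^esub> a \<otimes>\<^bsub>A\<^esub> B b c) \<and>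
    (\<forall>a\<in>carrier A. \<forall>b\<in>carrier A. \<forall>c\<in>carrier A.
      B a (b \<otimes>\<^bsub>A\<^esub> c) = B a b \<otimes>\<^bsub>A\<^esub> c \<oplus>\<^bsub>A\<^esub> b \<otimes>\<^bsub>A\<^esub> B a c)"

definition antisymmetric_op :: "('a, 'm) ring_scheme \<Rightarrow> ('a \<Rightarrow> 'a \<Rightarrow> 'a) \<Rightarrow> bool"
  where "antisymmetric_op A B \<longleftrightarrow> (\<forall>a\<in>carrier A. B a a = \<zero>\<^bsub>A\<^esub>)"

locale lie_algebra = module R L for R (structure) and L (structure) +
  fixes bracket :: "'c \<Rightarrow> 'c \<Rightarrow> 'c"
  assumes bracket_bilinear: "bilinear_op R L bracket"
    and bracket_self: "a \<in> carrier L \<Longrightarrow> bracket a a = \<zero>\<^bsub>L\<^esub>"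
    and jacobi: "\<lbrakk>a \<in> carrier L; b \<in> carrier L; c \<in> carrier L\<rbrakk> \<Longrightarrow>
      bracket a (bracket b c) \<oplus>\<^bsub>L\<^esub> bracket b (bracket c a) \<oplus>\<^bsub>L\<^esub> bracket c (bracket a b) = \<zero>\<^bsub>L\<^esub>"

locale poisson_structure = assoc_algebra R A + lie_algebra R A bracket
  for R (structure) and A (structure) and bracket +
  assumes leibniz: "\<lbrakk>a \<in> carrier A; b \<in> carrier A; c \<in> carrier A\<rbrakk> \<Longrightarrow>
      bracket a (b \<otimes>\<^bsub>A\<^esub> c) = bracket a b \<otimes>\<^bsub>A\<^esub> c \<oplus>\<^bsub>A\<^esub> b \<otimes>\<^bsub>A\<^esub> bracket a c"

section \<open>The finitary incidence algebra\<close>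

text \<open>
  A formal sum over the pairs \<open>x \<sqsubseteq> y\<close> of \<open>P\<close> is represented by its coefficient function,
  extended by zero to all other pairs.
\<close>

definition incidence_series ::
    "('p, 'q) gorder_scheme \<Rightarrow> ('r, 'k) ring_scheme \<Rightarrow> ('p \<Rightarrow> 'p \<Rightarrow> 'r) set"
  where "incidence_series P R =
    {f. (\<forall>x y. f x y \<in> carrier R) \<and>
        (\<forall>x y. \<not> (x \<in> carrier P \<and> y \<in> carrier P \<and> x \<sqsubseteq>\<^bsub>P\<^esub> y) \<longrightarrow> f x y = \<zero>\<^bsub>R\<^esub>)}"

definition finitary_series ::
    "('p, 'q) gorder_scheme \<Rightarrow> ('r, 'k) ring_scheme \<Rightarrow> ('p \<Rightarrow> 'p \<Rightarrow> 'r) set"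
  where "finitary_series P R =
    {f \<in> incidence_series P R. \<forall>x\<in>carrier P. \<forall>y\<in>carrier P. x \<sqsubset>\<^bsub>P\<^esub> y \<longrightarrow>
      finite {(u, v). u \<in> carrier P \<and> v \<in> carrier P \<and>
        x \<sqsubseteq>\<^bsub>P\<^esub> u \<and> u \<sqsubset>\<^bsub>P\<^esub> v \<and> v \<sqsubseteq>\<^bsub>P\<^esub> y \<and> f u v \<noteq> \<zero>\<^bsub>R\<^esub>}}"

text \<open>
  The interval from \<open>x\<close> to \<open>y\<close> may be infinite, and \<^const>\<open>finsum\<close> over an infinite set is zero by
  convention.  The convolution therefore sums only over those \<open>z\<close> at which both factors are
  nonzero; for finitary series there are finitely many of them.
\<close>

definition convolution ::
    "('p, 'q) gorder_scheme \<Rightarrow> ('r, 'k) ring_scheme \<Rightarrow>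
      ('p \<Rightarrow> 'p \<Rightarrow> 'r) \<Rightarrow> ('p \<Rightarrow> 'p \<Rightarrow> 'r) \<Rightarrow> 'p \<Rightarrow> 'p \<Rightarrow> 'r"
  where "convolution P R f g = (\<lambda>x y.
    \<Oplus>\<^bsub>R\<^esub>z\<in>{z \<in> carrier P. x \<sqsubseteq>\<^bsub>P\<^esub> z \<and> z \<sqsubseteq>\<^bsub>P\<^esub> y \<and> f x z \<noteq> \<zero>\<^bsub>R\<^esub> \<and> g z y \<noteq> \<zero>\<^bsub>R\<^esub>}.
      f x z \<otimes>\<^bsub>R\<^esub> g z y)"

definition FI ::
    "('p, 'q) gorder_scheme \<Rightarrow> ('r, 'k) ring_scheme \<Rightarrow> ('r, 'p \<Rightarrow> 'p \<Rightarrow> 'r) module"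
  where "FI P R =
    \<lparr> carrier = finitary_series P R,
      mult = convolution P R,
      one = (\<lambda>x y. if x \<in> carrier P \<and> x = y then \<one>\<^bsub>R\<^esub> else \<zero>\<^bsub>R\<^esub>),
      zero = (\<lambda>x y. \<zero>\<^bsub>R\<^esub>),
      add = (\<lambda>f g x y. f x y \<oplus>\<^bsub>R\<^esub> g x y),
      smult = (\<lambda>r f x y. r \<otimes>\<^bsub>R\<^esub> f x y) \<rparr>"

end

theory Submission
  imports Defs
begin

text \<open>
  Write \<open>J\<close> for the Jacobiator of an antisymmetric biderivation \<open>B\<close>.  Expanding \<open>B(au, bv)\<close> in two
  ways gives \<open>B(a, b) z [u, v] = [a, b] z B(u, v)\<close>.  For \<open>x < y\<close> the matrix unit \<open>e\<^sub>x\<^sub>y\<close> is the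
  commutator of \<open>e\<^sub>x\<^sub>x\<close> and \<open>e\<^sub>x\<^sub>y\<close>, and \<open>B(e\<^sub>x\<^sub>x, e\<^sub>x\<^sub>y)\<close> is a multiple \<open>c e\<^sub>x\<^sub>y\<close>, so that next to
  \<open>e\<^sub>x\<^sub>y\<close> the map \<open>B\<close> acts as \<open>c\<close> times the commutator.  The Jacobi identity of the commutator then
  yields \<open>J(f, g, h) e\<^sub>x\<^sub>y = 0 = e\<^sub>x\<^sub>y J(f, g, h)\<close>, so only the entries of \<open>J(f, g, h)\<close> from a minimal
  to a maximal element can be nonzero.  Since \<open>J\<close> is a linear derivation in each argument, such an
  entry at \<open>(x, y)\<close> is determined by the values of \<open>J\<close> on \<open>e\<^sub>x\<^sub>x\<close>, \<open>e\<^sub>y\<^sub>y\<close> and \<open>e\<^sub>x\<^sub>y\<close>, where a direct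
  computation gives zero.
\<close>

section \<open>Antisymmetric biderivations of a ring\<close>

locale antisymmetric_biderivation = ring A for A (structure) +
  fixes B
  assumes biderivation: "biderivation A B"
    and antisymmetric: "antisymmetric_op A B"
begin

section \<open>Leibniz calculus of \<open>B\<close> and its exchange with commutators\<close>

lemma B_closed [simp, intro]: "a \<in> carrier A \<Longrightarrow> b \<in> carrier A \<Longrightarrow> B a b \<in> carrier A"
  and B_add_left: "\<lbrakk>a \<in> carrier A; b \<in> carrier A; c \<in> carrier A\<rbrakk> \<Longrightarrow> B (a \<oplus> b) c = B a c \<oplus> B b c"
  and B_add_right: "\<lbrakk>a \<in> carrier A; b \<in> carrier A; c \<in> carrier A\<rbrakk> \<Longrightarrow> B a (b \<oplus> c) = B a b \<oplus> B a c"
  and B_mult_left: "\<lbrakk>a \<in> carrier A; b \<in> carrier A; c \<in> carrier A\<rbrakk> \<Longrightarrow>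
      B (a \<otimes> b) c = B a c \<otimes> b \<oplus> a \<otimes> B b c"
  and B_mult_right: "\<lbrakk>a \<in> carrier A; b \<in> carrier A; c \<in> carrier A\<rbrakk> \<Longrightarrow>
      B a (b \<otimes> c) = B a b \<otimes> c \<oplus> b \<otimes> B a c"
  and B_self: "a \<in> carrier A \<Longrightarrow> B a a = \<zero>"
  using biderivation antisymmetric
  unfolding biderivation_def biadditive_op_def antisymmetric_op_def by blast+

lemma B_skew:
  assumes "a \<in> carrier A" "b \<in> carrier A"
  shows "B b a = \<ominus> B a b"
proof -
  have "B (a \<oplus> b) (a \<oplus> b) = B b a \<oplus> B a b"
    using assms by (subst B_add_left) (simp_all add: B_add_right B_self a_comm)
  then have "B b a \<oplus> B a b = \<zero>"
    using assms B_self[of "a \<oplus> b"] by simp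
  then show ?thesis
    using assms minus_equality[of "B b a" "B a b"] by simp
qed

lemma B_zero_right: "a \<in> carrier A \<Longrightarrow> B a \<zero> = \<zero>"
  using B_add_right[of a \<zero> \<zero>] by (metis B_closed add.l_cancel_one' zero_closed r_zero)

lemma B_minus_right:
  assumes "a \<in> carrier A" "b \<in> carrier A"
  shows "B a (\<ominus> b) = \<ominus> B a b"
  using assms B_add_right[of a "\<ominus> b" b] B_zero_right[of a]
  by (simp add: l_neg minus_equality)

text \<open>Expanding \<open>B (a \<otimes> u) (b \<otimes> v)\<close> in the first argument first
  or in the second argument first produces the same two mixed terms aB(u, b)v and bB(a, v)u.
  Comparing what is left gives the identity.\<close>

lemma B_commutator:
  assumes [simp]: "a \<in> carrier A" "b \<in> carrier A" "u \<in> carrier A" "v \<in> carrier A"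
  shows "B a b \<otimes> (u \<otimes> v \<ominus> v \<otimes> u) = (a \<otimes> b \<ominus> b \<otimes> a) \<otimes> B u v"
proof -
  have 1: "B (a \<otimes> u) (b \<otimes> v) =
      (B a b \<otimes> v \<oplus> b \<otimes> B a v) \<otimes> u \<oplus> a \<otimes> (B u b \<otimes> v \<oplus> b \<otimes> B u v)"
    by (simp add: B_mult_left[of a u "b \<otimes> v"] B_mult_right[of a] B_mult_right[of u])
  have 2: "B (a \<otimes> u) (b \<otimes> v) =
      (B a b \<otimes> u \<oplus> a \<otimes> B u b) \<otimes> v \<oplus> b \<otimes> (B a v \<otimes> u \<oplus> a \<otimes> B u v)"
    by (simp add: B_mult_left[of _ _ b] B_mult_left[of _ _ v] B_mult_right[of "a \<otimes> u"])
  \<comment> \<open>The difference of the expansions \<open>2\<close> and \<open>1\<close>, which is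
    zero, is added on the right. In this form the equation is a plain ring identity that treats the
    values of \<open>B\<close> as unrelated elements.\<close>
  have "B a b \<otimes> (u \<otimes> v \<ominus> v \<otimes> u) =
     ((B a b \<otimes> u \<oplus> a \<otimes> B u b) \<otimes> v \<oplus> b \<otimes> (B a v \<otimes> u \<oplus> a \<otimes> B u v))
     \<ominus> ((B a b \<otimes> v \<oplus> b \<otimes> B a v) \<otimes> u \<oplus> a \<otimes> (B u b \<otimes> v \<oplus> b \<otimes> B u v))
     \<oplus> (a \<otimes> b \<ominus> b \<otimes> a) \<otimes> B u v"
    using assms B_closed by algebra
  also have "\<dots> = (a \<otimes> b \<ominus> b \<otimes> a) \<otimes> B u v"
    by (simp add: 1[symmetric, unfolded 2] minus_eq[of "_ \<oplus> _"] r_neg)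
  finally show ?thesis .
qed

text \<open>Substitute zu for u in \<open>B_commutator\<close>: since [zu, v] = z[u, v] + [z, v]u
  and B(zu, v) = B(z, v)u + zB(u, v), the contributions of [z, v]u and B(z, v)u cancel.\<close>

lemma B_mult_commutator:
  assumes [simp]: "a \<in> carrier A" "b \<in> carrier A" "z \<in> carrier A" "u \<in> carrier A" "v \<in> carrier A"
  shows "B a b \<otimes> z \<otimes> (u \<otimes> v \<ominus> v \<otimes> u) = (a \<otimes> b \<ominus> b \<otimes> a) \<otimes> z \<otimes> B u v"
proof -
  have "B a b \<otimes> z \<otimes> (u \<otimes> v \<ominus> v \<otimes> u) =
      B a b \<otimes> ((z \<otimes> u) \<otimes> v \<ominus> v \<otimes> (z \<otimes> u)) \<ominus> (B a b \<otimes> (z \<otimes> v \<ominus> v \<otimes> z)) \<otimes> u"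
    using assms B_closed by algebra
  also have "\<dots> = (a \<otimes> b \<ominus> b \<otimes> a) \<otimes> (B z v \<otimes> u \<oplus> z \<otimes> B u v) \<ominus> ((a \<otimes> b \<ominus> b \<otimes> a) \<otimes> B z v) \<otimes> u"
    by (simp add: B_commutator B_mult_left)
  also have "\<dots> = (a \<otimes> b \<ominus> b \<otimes> a) \<otimes> z \<otimes> B u v"
    using assms B_closed by algebra
  finally show ?thesis .
qed

text \<open>Computing B(ef, f) = B(fe, f) with B(f, f) = 0 shows that B(e, f) commutes with f. Then
  f = ff gives B(e, f) = 2fB(e, f); multiplying by f yields fB(e, f) = 2fB(e, f), so fB(e, f) = 0
  and hence B(e, f) = 0.\<close>

lemma B_commuting_idempotent:
  assumes [simp]: "e \<in> carrier A" "f \<in> carrier A" and "f \<otimes> f = f" "e \<otimes> f = f \<otimes> e"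
  shows "B e f = \<zero>"
proof -
  have "B e f \<otimes> f = B (e \<otimes> f) f" "f \<otimes> B e f = B (f \<otimes> e) f"
    by (simp_all add: B_mult_left B_self)
  then have comm: "B e f \<otimes> f = f \<otimes> B e f"
    using assms by simp
  have B: "B e f = B e f \<otimes> f \<oplus> f \<otimes> B e f"
    using B_mult_right[of e f f] assms by simp
  have "f \<otimes> B e f = f \<otimes> (f \<otimes> B e f \<oplus> f \<otimes> B e f)"
    using B comm by simp
  also have "\<dots> = f \<otimes> B e f \<oplus> f \<otimes> B e f"
    using assms by (simp add: r_distr m_assoc[symmetric])
  finally have "f \<otimes> B e f = \<zero>"
    by (metis B_closed add.l_cancel_one' assms(1,2) m_closed)
  then show ?thesis
    using B comm by simp
qed

section \<open>The Jacobiator: symmetries, Leibniz rule and annihilation by commutators\<close>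

definition jacobiator :: "'a \<Rightarrow> 'a \<Rightarrow> 'a \<Rightarrow> 'a"
  where "jacobiator a b c = B a (B b c) \<oplus> B b (B c a) \<oplus> B c (B a b)"

lemma jacobiator_closed [simp, intro]:
  "\<lbrakk>a \<in> carrier A; b \<in> carrier A; c \<in> carrier A\<rbrakk> \<Longrightarrow> jacobiator a b c \<in> carrier A"
  by (simp add: jacobiator_def)

lemma jacobiator_cyclic:
  "\<lbrakk>a \<in> carrier A; b \<in> carrier A; c \<in> carrier A\<rbrakk> \<Longrightarrow> jacobiator a b c = jacobiator b c a"
  by (simp add: jacobiator_def a_ac)

text \<open>The two nested terms cancel by skew-symmetry of \<open>B\<close>. Alternation under
  swapping arguments would only give that twice the value is zero, which is weaker in the presence
  of 2-torsion.\<close>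

lemma jacobiator_self:
  "\<lbrakk>a \<in> carrier A; b \<in> carrier A\<rbrakk> \<Longrightarrow> jacobiator a a b = \<zero>"
  by (simp add: jacobiator_def B_self B_zero_right B_skew[of a b] B_minus_right r_neg)

lemma jacobiator_skew:
  assumes "a \<in> carrier A" "b \<in> carrier A" "c \<in> carrier A"
  shows "jacobiator b a c = \<ominus> jacobiator a b c"
  using assms
  by (simp add: jacobiator_def B_skew[of a b] B_skew[of a c] B_skew[of b c] B_minus_right a_ac minus_add)

lemma jacobiator_mult:
  assumes [simp]: "a \<in> carrier A" "b \<in> carrier A" "c \<in> carrier A" "d \<in> carrier A"
  shows "jacobiator a b (c \<otimes> d) = jacobiator a b c \<otimes> d \<oplus> c \<otimes> jacobiator a b d"
proof -
  \<comment> \<open>In this form J(a, b, -) is the commutator of the derivations B(a, -) and B(b, -)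
    minus the derivation B(B(a, b), -), hence itself a derivation.\<close>
  have J: "jacobiator a b x = B a (B b x) \<ominus> B b (B a x) \<ominus> B (B a b) x" if "x \<in> carrier A" for x
    using that
    by (simp add: jacobiator_def B_skew[of "B a b" x] B_skew[of a x] B_minus_right minus_eq)
  have "B a b \<in> carrier A" "B a c \<in> carrier A" "B a d \<in> carrier A" "B b c \<in> carrier A"
    "B b d \<in> carrier A" "B a (B b c) \<in> carrier A" "B a (B b d) \<in> carrier A"
    "B b (B a c) \<in> carrier A" "B b (B a d) \<in> carrier A"
    "B (B a b) c \<in> carrier A" "B (B a b) d \<in> carrier A"
    by simp_all
  moreover have "jacobiator a b (c \<otimes> d) =
      (B a (B b c) \<otimes> d \<oplus> B b c \<otimes> B a d \<oplus> (B a c \<otimes> B b d \<oplus> c \<otimes> B a (B b d)))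
      \<ominus> (B b (B a c) \<otimes> d \<oplus> B a c \<otimes> B b d \<oplus> (B b c \<otimes> B a d \<oplus> c \<otimes> B b (B a d)))
      \<ominus> (B (B a b) c \<otimes> d \<oplus> c \<otimes> B (B a b) d)"
    by (simp add: J B_mult_right B_add_right)
  ultimately show ?thesis
    unfolding J[OF assms(3)] J[OF assms(4)] using assms(3,4) by algebra
qed

lemma jacobiator_mult_commutator:
  assumes [simp]: "a \<in> carrier A" "b \<in> carrier A" "c \<in> carrier A"
    "u \<in> carrier A" "v \<in> carrier A" "q \<in> carrier A"
    and q: "B u v = q \<otimes> (u \<otimes> v \<ominus> v \<otimes> u)"
  shows "jacobiator a b c \<otimes> (u \<otimes> v \<ominus> v \<otimes> u) = \<zero>"
proof -
  define p where "p = u \<otimes> v \<ominus> v \<otimes> u"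
  have [simp]: "p \<in> carrier A"
    by (simp add: p_def)
  have 1: "B x y \<otimes> z \<otimes> p = (x \<otimes> y \<ominus> y \<otimes> x) \<otimes> z \<otimes> (q \<otimes> p)"
    if "x \<in> carrier A" "y \<in> carrier A" "z \<in> carrier A" for x y z
    unfolding p_def using that B_mult_commutator[of x y z u v] q by simp
  have 2: "B x (B y z) \<otimes> p =
      (x \<otimes> (y \<otimes> z \<ominus> z \<otimes> y) \<ominus> (y \<otimes> z \<ominus> z \<otimes> y) \<otimes> x) \<otimes> (q \<otimes> (q \<otimes> p))"
    if [simp]: "x \<in> carrier A" "y \<in> carrier A" "z \<in> carrier A" for x y z
  proof -
    have "B x (B y z) \<otimes> p = (x \<otimes> B y z \<ominus> B y z \<otimes> x) \<otimes> (q \<otimes> p)"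
      using 1[of x "B y z" \<one>] by simp
    \<comment> \<open>Regrouped so that \<open>B y z\<close> is separated from the final p or qp
      only by a middle factor, q or xq; \<open>1\<close> applies to both.\<close>
    also have "\<dots> = x \<otimes> (B y z \<otimes> q \<otimes> p) \<ominus> B y z \<otimes> (x \<otimes> q) \<otimes> p"
      using that \<open>q \<in> carrier A\<close> \<open>p \<in> carrier A\<close> B_closed[of y z] by algebra
    also have "\<dots> = (x \<otimes> (y \<otimes> z \<ominus> z \<otimes> y) \<ominus> (y \<otimes> z \<ominus> z \<otimes> y) \<otimes> x) \<otimes> (q \<otimes> (q \<otimes> p))"
      unfolding 1[OF that(2,3) \<open>q \<in> carrier A\<close>] 1[OF that(2,3) m_closed[OF that(1) \<open>q \<in> carrier A\<close>]]
      using that \<open>q \<in> carrier A\<close> \<open>p \<in> carrier A\<close> by algebra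
    finally show ?thesis .
  qed
  define r where "r = q \<otimes> (q \<otimes> p)"
  have [simp]: "r \<in> carrier A" by (simp add: r_def)
  show ?thesis
    unfolding p_def[symmetric] jacobiator_def
    apply (simp add: l_distr 2 r_def[symmetric])
    using assms(1-3) \<open>r \<in> _\<close> by algebra
qed

text \<open>Mirror image of the previous argument: p = [u, v] stands on the left, and each exchange
  of \<open>B\<close> for a commutator leaves a factor q directly behind it.\<close>

lemma commutator_mult_jacobiator:
  assumes [simp]: "a \<in> carrier A" "b \<in> carrier A" "c \<in> carrier A"
    "u \<in> carrier A" "v \<in> carrier A" "q \<in> carrier A"
    and q: "B u v = (u \<otimes> v \<ominus> v \<otimes> u) \<otimes> q"
  shows "(u \<otimes> v \<ominus> v \<otimes> u) \<otimes> jacobiator a b c = \<zero>"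
proof -
  define p where "p = u \<otimes> v \<ominus> v \<otimes> u"
  have [simp]: "p \<in> carrier A"
    by (simp add: p_def)
  have 1: "p \<otimes> z \<otimes> B x y = p \<otimes> q \<otimes> z \<otimes> (x \<otimes> y \<ominus> y \<otimes> x)"
    if "x \<in> carrier A" "y \<in> carrier A" "z \<in> carrier A" for x y z
    unfolding p_def using that B_mult_commutator[of u v z x y] q by simp
  have 2: "p \<otimes> B x (B y z) =
      (p \<otimes> q \<otimes> q) \<otimes> (x \<otimes> (y \<otimes> z \<ominus> z \<otimes> y) \<ominus> (y \<otimes> z \<ominus> z \<otimes> y) \<otimes> x)"
    if [simp]: "x \<in> carrier A" "y \<in> carrier A" "z \<in> carrier A" for x y z
  proof -
    have "p \<otimes> B x (B y z) = p \<otimes> q \<otimes> (x \<otimes> B y z \<ominus> B y z \<otimes> x)"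
      using 1[of x "B y z" \<one>] by simp
    also have "\<dots> = p \<otimes> (q \<otimes> x) \<otimes> B y z \<ominus> (p \<otimes> q \<otimes> B y z) \<otimes> x"
      using that \<open>q \<in> carrier A\<close> \<open>p \<in> carrier A\<close> B_closed[of y z] by algebra
    also have "\<dots> = (p \<otimes> q \<otimes> q) \<otimes> (x \<otimes> (y \<otimes> z \<ominus> z \<otimes> y) \<ominus> (y \<otimes> z \<ominus> z \<otimes> y) \<otimes> x)"
      unfolding 1[OF that(2,3) \<open>q \<in> carrier A\<close>] 1[OF that(2,3) m_closed[OF \<open>q \<in> carrier A\<close> that(1)]]
      using that \<open>q \<in> carrier A\<close> \<open>p \<in> carrier A\<close> by algebra
    finally show ?thesis .
  qed
  define r where "r = p \<otimes> q \<otimes> q"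
  have [simp]: "r \<in> carrier A" by (simp add: r_def)
  show ?thesis
    unfolding p_def[symmetric] jacobiator_def
    apply (simp add: r_distr 2 r_def[symmetric])
    using assms(1-3) \<open>r \<in> _\<close> by algebra
qed

end

section \<open>The ring structure of the finitary incidence algebra\<close>

lemma (in abelian_monoid) finsum_swap:
  assumes "finite S" "finite T" "\<And>i j. h i j \<in> carrier G"
  shows "(\<Oplus>i\<in>S. \<Oplus>j\<in>T. h i j) = (\<Oplus>j\<in>T. \<Oplus>i\<in>S. h i j)"
  using assms(1)
proof (induction S)
  case empty
  then show ?case
    by (simp add: finsum_zero)
next
  case (insert k S)
  then show ?case
    using assms(2,3) by (simp add: finsum_addf Pi_def finsum_closed)
qed

locale finitary_incidence = R?: cring R + P: partial_order P
  for R (structure) and P (structure)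
begin

section \<open>Supports of finitary series and convolution as a finite sum\<close>

lemma carrier_FI: "carrier (FI P R) = finitary_series P R"
  and mult_FI: "f \<otimes>\<^bsub>FI P R\<^esub> g = convolution P R f g"
  and one_FI: "\<one>\<^bsub>FI P R\<^esub> = (\<lambda>x y. if x \<in> carrier P \<and> x = y then \<one> else \<zero>)"
  and zero_FI [simp]: "\<zero>\<^bsub>FI P R\<^esub> = (\<lambda>x y. \<zero>)"
  and add_FI [simp]: "f \<oplus>\<^bsub>FI P R\<^esub> g = (\<lambda>x y. f x y \<oplus> g x y)"
  and smult_FI [simp]: "r \<odot>\<^bsub>FI P R\<^esub> f = (\<lambda>x y. r \<otimes> f x y)"
  by (simp_all add: FI_def)

lemma FI_coeff_closed [simp]: "f \<in> carrier (FI P R) \<Longrightarrow> f x y \<in> carrier R"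
  by (simp add: carrier_FI finitary_series_def incidence_series_def)

lemma FI_coeff_nonzero:
  assumes "f \<in> carrier (FI P R)" "f x y \<noteq> \<zero>"
  shows "x \<in> carrier P" "y \<in> carrier P" "x \<sqsubseteq>\<^bsub>P\<^esub> y"
  using assms unfolding carrier_FI finitary_series_def incidence_series_def by blast+

text \<open>The defining condition speaks of x < y only. If x < y fails, the set is empty: a member
  would give x \<le> u \<le> v \<le> y, so x = y, and antisymmetry would force u = v. A nonzero
  coefficient already supplies u \<le> v and membership in P.\<close>

lemma FI_finite:
  assumes "f \<in> carrier (FI P R)" "x \<in> carrier P" "y \<in> carrier P"
  shows "finite {(u, v). x \<sqsubseteq>\<^bsub>P\<^esub> u \<and> u \<noteq> v \<and> v \<sqsubseteq>\<^bsub>P\<^esub> y \<and> f u v \<noteq> \<zero>}" (is "finite ?S")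
proof (cases "x \<sqsubset>\<^bsub>P\<^esub> y")
  case True
  have "?S \<subseteq> {(u, v). u \<in> carrier P \<and> v \<in> carrier P \<and>
      x \<sqsubseteq>\<^bsub>P\<^esub> u \<and> u \<sqsubset>\<^bsub>P\<^esub> v \<and> v \<sqsubseteq>\<^bsub>P\<^esub> y \<and> f u v \<noteq> \<zero>}"
    using FI_coeff_nonzero[OF assms(1)] by (auto simp: P.lless_eq)
  moreover have "finite \<dots>"
    using assms True unfolding carrier_FI finitary_series_def by blast
  ultimately show ?thesis
    by (rule finite_subset)
next
  case False
  have "?S = {}"
  proof (rule ccontr)
    assume "?S \<noteq> {}"
    then obtain u v where uv: "x \<sqsubseteq>\<^bsub>P\<^esub> u" "u \<noteq> v" "v \<sqsubseteq>\<^bsub>P\<^esub> y" "f u v \<noteq> \<zero>"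
      by auto
    note c = FI_coeff_nonzero[OF assms(1) uv(4)]
    have "x \<sqsubseteq>\<^bsub>P\<^esub> v" "x \<sqsubseteq>\<^bsub>P\<^esub> y"
      using P.le_trans uv c assms by meson+
    with False have "x = y"
      by (simp add: P.lless_eq)
    then show False
      using P.le_antisym P.le_trans uv c assms by metis
  qed
  then show ?thesis
    by (simp only: finite.emptyI)
qed

lemma FI_I:
  assumes "\<And>x y. f x y \<in> carrier R"
    and "\<And>x y. f x y \<noteq> \<zero> \<Longrightarrow> x \<in> carrier P \<and> y \<in> carrier P \<and> x \<sqsubseteq>\<^bsub>P\<^esub> y"
    and "\<And>x y. x \<in> carrier P \<Longrightarrow> y \<in> carrier P \<Longrightarrow>
      finite {(u, v). x \<sqsubseteq>\<^bsub>P\<^esub> u \<and> u \<noteq> v \<and> v \<sqsubseteq>\<^bsub>P\<^esub> y \<and> f u v \<noteq> \<zero>}"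
  shows "f \<in> carrier (FI P R)"
proof -
  have "finite {(u, v). u \<in> carrier P \<and> v \<in> carrier P \<and>
      x \<sqsubseteq>\<^bsub>P\<^esub> u \<and> u \<sqsubset>\<^bsub>P\<^esub> v \<and> v \<sqsubseteq>\<^bsub>P\<^esub> y \<and> f u v \<noteq> \<zero>}"
    if "x \<in> carrier P" "y \<in> carrier P" for x y
    using assms(3)[OF that] by (rule rev_finite_subset) (auto simp: P.lless_eq)
  then show ?thesis
    using assms(1,2) unfolding carrier_FI finitary_series_def incidence_series_def by blast
qed

text \<open>Apart from z = x, every such z is the second component of a pair in the finite set of
  \<open>FI_finite\<close>; a row indexed outside P is zero.\<close>

lemma finite_row:
  assumes "f \<in> carrier (FI P R)" "y \<in> carrier P"
  shows "finite {z. z \<sqsubseteq>\<^bsub>P\<^esub> y \<and> f x z \<noteq> \<zero>}"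
proof (cases "x \<in> carrier P")
  case True
  have "{z. z \<sqsubseteq>\<^bsub>P\<^esub> y \<and> f x z \<noteq> \<zero>} \<subseteq>
      insert x (snd ` {(u, v). x \<sqsubseteq>\<^bsub>P\<^esub> u \<and> u \<noteq> v \<and> v \<sqsubseteq>\<^bsub>P\<^esub> y \<and> f u v \<noteq> \<zero>})"
    using True by (force simp: image_iff)
  then show ?thesis
    using FI_finite[OF assms(1) True assms(2)] by (simp add: finite_subset)
next
  case False
  then have "{z. z \<sqsubseteq>\<^bsub>P\<^esub> y \<and> f x z \<noteq> \<zero>} = {}"
    using FI_coeff_nonzero[OF assms(1)] by blast
  then show ?thesis
    by (simp only: finite.emptyI)
qed

lemma finite_column:
  assumes "f \<in> carrier (FI P R)" "x \<in> carrier P"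
  shows "finite {z. x \<sqsubseteq>\<^bsub>P\<^esub> z \<and> f z y \<noteq> \<zero>}"
proof (cases "y \<in> carrier P")
  case True
  have "{z. x \<sqsubseteq>\<^bsub>P\<^esub> z \<and> f z y \<noteq> \<zero>} \<subseteq>
      insert y (fst ` {(u, v). x \<sqsubseteq>\<^bsub>P\<^esub> u \<and> u \<noteq> v \<and> v \<sqsubseteq>\<^bsub>P\<^esub> y \<and> f u v \<noteq> \<zero>})"
    using True by (force simp: image_iff)
  then show ?thesis
    using FI_finite[OF assms True] by (simp add: finite_subset)
next
  case False
  then have "{z. x \<sqsubseteq>\<^bsub>P\<^esub> z \<and> f z y \<noteq> \<zero>} = {}"
    using FI_coeff_nonzero[OF assms(1)] by blast
  then show ?thesis
    by (simp only: finite.emptyI)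
qed

text \<open>The index set of \<open>convolution\<close> depends on both factors. Replacing it by any
  finite set containing it lets several products be summed over a common set.\<close>

lemma mult_FI_eq_finsum:
  assumes "f \<in> carrier (FI P R)" "g \<in> carrier (FI P R)" "finite T"
    and "\<And>z. \<lbrakk>x \<sqsubseteq>\<^bsub>P\<^esub> z; z \<sqsubseteq>\<^bsub>P\<^esub> y; f x z \<noteq> \<zero>; g z y \<noteq> \<zero>\<rbrakk> \<Longrightarrow> z \<in> T"
  shows "(f \<otimes>\<^bsub>FI P R\<^esub> g) x y = (\<Oplus>z\<in>T. f x z \<otimes> g z y)"
  unfolding mult_FI convolution_def
proof (rule add.finprod_mono_neutral_cong_left)
  fix z
  assume "z \<in> T - {z \<in> carrier P. x \<sqsubseteq>\<^bsub>P\<^esub> z \<and> z \<sqsubseteq>\<^bsub>P\<^esub> y \<and> f x z \<noteq> \<zero> \<and> g z y \<noteq> \<zero>}"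
  \<comment> \<open>This includes points of \<open>T\<close> outside P or outside the interval,
    where a coefficient is zero because the order relation fails.\<close>
  then have "f x z = \<zero> \<or> g z y = \<zero>"
    using FI_coeff_nonzero[OF assms(1)] FI_coeff_nonzero[OF assms(2)] by blast
  then show "f x z \<otimes> g z y = \<zero>"
    using assms(1,2) by auto
qed (use assms in auto)

lemma mult_FI_eq_zero:
  assumes "\<And>z. \<lbrakk>z \<in> carrier P; x \<sqsubseteq>\<^bsub>P\<^esub> z; z \<sqsubseteq>\<^bsub>P\<^esub> y\<rbrakk> \<Longrightarrow> f x z \<otimes> g z y = \<zero>"
  shows "(f \<otimes>\<^bsub>FI P R\<^esub> g) x y = \<zero>"
  unfolding mult_FI convolution_def by (rule add.finprod_one_eqI) (use assms in auto)

lemma mult_FI_nonzero: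
  assumes "f \<in> carrier (FI P R)" "g \<in> carrier (FI P R)" "(f \<otimes>\<^bsub>FI P R\<^esub> g) x y \<noteq> \<zero>"
  obtains z where "z \<in> carrier P" "x \<sqsubseteq>\<^bsub>P\<^esub> z" "z \<sqsubseteq>\<^bsub>P\<^esub> y" "f x z \<noteq> \<zero>" "g z y \<noteq> \<zero>"
proof -
  obtain z where "z \<in> carrier P" "x \<sqsubseteq>\<^bsub>P\<^esub> z" "z \<sqsubseteq>\<^bsub>P\<^esub> y" "f x z \<otimes> g z y \<noteq> \<zero>"
    using mult_FI_eq_zero assms(3) by blast
  then show thesis
    using that[of z] assms(1,2) l_null[of "g z y"] r_null[of "f x z"] by fastforce
qed

text \<open>A nonzero (fg)(u, v) passes through some z with f(u, z) and g(z, v) nonzero. If z = u or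
  z = v, then (u, v) is in the support of g or f; otherwise u starts an off-diagonal pair of f and v
  ends one of g. Within a fixed interval each possibility leaves finitely many pairs.\<close>

lemma mult_FI_closed:
  assumes f: "f \<in> carrier (FI P R)" and g: "g \<in> carrier (FI P R)"
  shows "f \<otimes>\<^bsub>FI P R\<^esub> g \<in> carrier (FI P R)"
proof (rule FI_I)
  fix x y
  show "(f \<otimes>\<^bsub>FI P R\<^esub> g) x y \<in> carrier R"
    unfolding mult_FI convolution_def using assms by (auto intro: finsum_closed)
  show "x \<in> carrier P \<and> y \<in> carrier P \<and> x \<sqsubseteq>\<^bsub>P\<^esub> y" if "(f \<otimes>\<^bsub>FI P R\<^esub> g) x y \<noteq> \<zero>"
    using mult_FI_nonzero[OF assms that] FI_coeff_nonzero[OF f] FI_coeff_nonzero[OF g] P.le_trans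
    by metis
  assume xy: "x \<in> carrier P" "y \<in> carrier P"
  define S where "S h = {(u, v). x \<sqsubseteq>\<^bsub>P\<^esub> u \<and> u \<noteq> v \<and> v \<sqsubseteq>\<^bsub>P\<^esub> y \<and> h u v \<noteq> \<zero>}"
    for h :: "'c \<Rightarrow> 'c \<Rightarrow> 'a"
  have "(u, v) \<in> S f \<union> S g \<union> fst ` S f \<times> snd ` S g" if uv: "(u, v) \<in> S (f \<otimes>\<^bsub>FI P R\<^esub> g)" for u v
  proof -
    from uv obtain z where z: "z \<in> carrier P" "u \<sqsubseteq>\<^bsub>P\<^esub> z" "z \<sqsubseteq>\<^bsub>P\<^esub> v" "f u z \<noteq> \<zero>" "g z v \<noteq> \<zero>"
      unfolding S_def by (auto elim: mult_FI_nonzero[OF assms])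
    have c: "u \<in> carrier P" "v \<in> carrier P"
      using FI_coeff_nonzero z f g by blast+
    have "x \<sqsubseteq>\<^bsub>P\<^esub> z" "z \<sqsubseteq>\<^bsub>P\<^esub> y"
      using uv z c xy P.le_trans unfolding S_def by blast+
    then have "(u, z) \<in> S f \<or> u = z" "(z, v) \<in> S g \<or> z = v"
      using uv z unfolding S_def by auto
    then show ?thesis
      using uv z unfolding S_def by (force simp: image_iff)
  qed
  then have "S (f \<otimes>\<^bsub>FI P R\<^esub> g) \<subseteq> S f \<union> S g \<union> fst ` S f \<times> snd ` S g"
    by auto
  moreover have "finite (S f)" "finite (S g)"
    unfolding S_def using FI_finite assms xy by blast+
  ultimately have "finite (S (f \<otimes>\<^bsub>FI P R\<^esub> g))"
    by (meson finite_SigmaI finite_UnI finite_imageI finite_subset)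
  then show "finite {(u, v). x \<sqsubseteq>\<^bsub>P\<^esub> u \<and> u \<noteq> v \<and> v \<sqsubseteq>\<^bsub>P\<^esub> y \<and> (f \<otimes>\<^bsub>FI P R\<^esub> g) u v \<noteq> \<zero>}"
    unfolding S_def .
qed

text \<open>The support of h lies in the union of two finitary supports. This covers sums, negatives
  and scalar multiples.\<close>

lemma pointwise_closed:
  assumes f: "f \<in> carrier (FI P R)" and g: "g \<in> carrier (FI P R)"
    and "\<And>x y. h x y \<in> carrier R"
    and "\<And>x y. f x y = \<zero> \<Longrightarrow> g x y = \<zero> \<Longrightarrow> h x y = \<zero>"
  shows "h \<in> carrier (FI P R)"
proof (rule FI_I)
  fix x y
  show "x \<in> carrier P \<and> y \<in> carrier P \<and> x \<sqsubseteq>\<^bsub>P\<^esub> y" if "h x y \<noteq> \<zero>"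
    using that assms(4) FI_coeff_nonzero[OF f] FI_coeff_nonzero[OF g] by blast
  assume "x \<in> carrier P" "y \<in> carrier P"
  from finite_UnI[OF FI_finite[OF f this] FI_finite[OF g this]]
  show "finite {(u, v). x \<sqsubseteq>\<^bsub>P\<^esub> u \<and> u \<noteq> v \<and> v \<sqsubseteq>\<^bsub>P\<^esub> y \<and> h u v \<noteq> \<zero>}"
    by (rule rev_finite_subset) (use assms(4) in blast)
qed (rule assms(3))

section \<open>Ring axioms for the convolution product\<close>

lemma FI_zero_closed: "(\<lambda>x y. \<zero>) \<in> carrier (FI P R)"
  by (rule FI_I) auto

lemma FI_one_closed: "\<one>\<^bsub>FI P R\<^esub> \<in> carrier (FI P R)"
  by (rule FI_I) (auto simp: one_FI split: if_splits intro: finite_subset[of _ "{}"])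

text \<open>For x and y in P, both sides are the same double sum over \<open>S\<close> and
  \<open>T\<close>, the supports of a row of f and of a column of h. These sets do not vary with the
  inner summation index, so the two sums can be exchanged.\<close>

lemma mult_FI_assoc:
  assumes f: "f \<in> carrier (FI P R)" and g: "g \<in> carrier (FI P R)" and h: "h \<in> carrier (FI P R)"
  shows "(f \<otimes>\<^bsub>FI P R\<^esub> g) \<otimes>\<^bsub>FI P R\<^esub> h = f \<otimes>\<^bsub>FI P R\<^esub> (g \<otimes>\<^bsub>FI P R\<^esub> h)"
proof (intro ext)
  fix x y
  show "((f \<otimes>\<^bsub>FI P R\<^esub> g) \<otimes>\<^bsub>FI P R\<^esub> h) x y = (f \<otimes>\<^bsub>FI P R\<^esub> (g \<otimes>\<^bsub>FI P R\<^esub> h)) x y"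
  proof (cases "x \<in> carrier P \<and> y \<in> carrier P")
    case True
    define S where "S = {z. z \<sqsubseteq>\<^bsub>P\<^esub> y \<and> f x z \<noteq> \<zero>}"
    define T where "T = {z. x \<sqsubseteq>\<^bsub>P\<^esub> z \<and> h z y \<noteq> \<zero>}"
    have fin: "finite S" "finite T"
      unfolding S_def T_def using finite_row finite_column True f h by auto
    have fg: "(f \<otimes>\<^bsub>FI P R\<^esub> g) x t = (\<Oplus>s\<in>S. f x s \<otimes> g s t)" if "t \<in> T" for t
    proof (rule mult_FI_eq_finsum[OF f g fin(1)])
      fix s
      assume s: "s \<sqsubseteq>\<^bsub>P\<^esub> t" "f x s \<noteq> \<zero>"
      have "t \<in> carrier P" "t \<sqsubseteq>\<^bsub>P\<^esub> y"
        using that FI_coeff_nonzero[OF h] unfolding T_def by auto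
      then show "s \<in> S"
        unfolding S_def using s FI_coeff_nonzero[OF f s(2)] True P.le_trans by blast
    qed
    have gh: "(g \<otimes>\<^bsub>FI P R\<^esub> h) s y = (\<Oplus>t\<in>T. g s t \<otimes> h t y)" if "s \<in> S" for s
    proof (rule mult_FI_eq_finsum[OF g h fin(2)])
      fix t
      assume t: "s \<sqsubseteq>\<^bsub>P\<^esub> t" "h t y \<noteq> \<zero>"
      have "s \<in> carrier P" "x \<sqsubseteq>\<^bsub>P\<^esub> s"
        using that FI_coeff_nonzero[OF f] unfolding S_def by auto
      then show "t \<in> T"
        unfolding T_def using t FI_coeff_nonzero[OF h t(2)] True P.le_trans by blast
    qed
    have "((f \<otimes>\<^bsub>FI P R\<^esub> g) \<otimes>\<^bsub>FI P R\<^esub> h) x y = (\<Oplus>t\<in>T. (f \<otimes>\<^bsub>FI P R\<^esub> g) x t \<otimes> h t y)"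
      by (rule mult_FI_eq_finsum[OF mult_FI_closed[OF f g] h fin(2)]) (simp add: T_def)
    also have "\<dots> = (\<Oplus>t\<in>T. \<Oplus>s\<in>S. f x s \<otimes> g s t \<otimes> h t y)"
      by (rule finsum_cong') (use fg f g h fin in \<open>auto simp: finsum_ldistr Pi_def intro!: finsum_closed\<close>)
    also have "\<dots> = (\<Oplus>s\<in>S. \<Oplus>t\<in>T. f x s \<otimes> g s t \<otimes> h t y)"
      by (rule finsum_swap) (use f g h fin in auto)
    also have "\<dots> = (\<Oplus>s\<in>S. f x s \<otimes> (g \<otimes>\<^bsub>FI P R\<^esub> h) s y)"
      by (rule finsum_cong')
        (use gh f g h fin in \<open>auto simp: finsum_rdistr Pi_def m_assoc intro!: finsum_closed\<close>)
    also have "\<dots> = (f \<otimes>\<^bsub>FI P R\<^esub> (g \<otimes>\<^bsub>FI P R\<^esub> h)) x y"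
      by (rule mult_FI_eq_finsum[OF f mult_FI_closed[OF g h] fin(1), symmetric]) (simp add: S_def)
    finally show ?thesis .
  next
    case False
    then have zero: "k x y = \<zero>" if "k \<in> carrier (FI P R)" for k
      using FI_coeff_nonzero[OF that] by blast
    then show ?thesis
      using f g h by (simp add: mult_FI_closed zero)
  qed
qed

text \<open>Row x of f is supported in the single column u, so the convolution has one term. This
  evaluates products with the identity and with matrix units.\<close>

lemma mult_FI_left_diagonal:
  assumes f: "f \<in> carrier (FI P R)" and g: "g \<in> carrier (FI P R)"
    and "\<And>z. z \<noteq> u \<Longrightarrow> f x z = \<zero>"
  shows "(f \<otimes>\<^bsub>FI P R\<^esub> g) x y = f x u \<otimes> g u y"
proof -
  have "(f \<otimes>\<^bsub>FI P R\<^esub> g) x y = (\<Oplus>z\<in>{u}. f x z \<otimes> g z y)"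
    by (rule mult_FI_eq_finsum[OF f g]) (use assms(3) in auto)
  then show ?thesis
    using f g by (simp add: finsum_insert)
qed

lemma mult_FI_right_diagonal:
  assumes f: "f \<in> carrier (FI P R)" and g: "g \<in> carrier (FI P R)"
    and "\<And>z. z \<noteq> u \<Longrightarrow> g z y = \<zero>"
  shows "(f \<otimes>\<^bsub>FI P R\<^esub> g) x y = f x u \<otimes> g u y"
proof -
  have "(f \<otimes>\<^bsub>FI P R\<^esub> g) x y = (\<Oplus>z\<in>{u}. f x z \<otimes> g z y)"
    by (rule mult_FI_eq_finsum[OF f g]) (use assms(3) in auto)
  then show ?thesis
    using f g by (simp add: finsum_insert)
qed

text \<open>The support of column y of h serves as a common index set for all three
  products.\<close>

lemma mult_FI_l_distr:
  assumes f: "f \<in> carrier (FI P R)" and g: "g \<in> carrier (FI P R)" and h: "h \<in> carrier (FI P R)"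
    and fg: "f \<oplus>\<^bsub>FI P R\<^esub> g \<in> carrier (FI P R)"
  shows "(f \<oplus>\<^bsub>FI P R\<^esub> g) \<otimes>\<^bsub>FI P R\<^esub> h = f \<otimes>\<^bsub>FI P R\<^esub> h \<oplus>\<^bsub>FI P R\<^esub> g \<otimes>\<^bsub>FI P R\<^esub> h"
proof (intro ext)
  fix x y
  show "((f \<oplus>\<^bsub>FI P R\<^esub> g) \<otimes>\<^bsub>FI P R\<^esub> h) x y = (f \<otimes>\<^bsub>FI P R\<^esub> h \<oplus>\<^bsub>FI P R\<^esub> g \<otimes>\<^bsub>FI P R\<^esub> h) x y"
  proof (cases "x \<in> carrier P")
    case True
    let ?T = "{z. x \<sqsubseteq>\<^bsub>P\<^esub> z \<and> h z y \<noteq> \<zero>}"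
    have eq: "(k \<otimes>\<^bsub>FI P R\<^esub> h) x y = (\<Oplus>z\<in>?T. k x z \<otimes> h z y)" if "k \<in> carrier (FI P R)" for k
      using finite_column[OF h True] by (rule mult_FI_eq_finsum[OF that h]) simp
    show ?thesis
      unfolding eq[OF fg] using f g h
      by (simp add: eq Pi_def l_distr)
  next
    case False
    then have zero: "k x y = \<zero>" if "k \<in> carrier (FI P R)" for k
      using FI_coeff_nonzero[OF that] by blast
    then show ?thesis
      using f g h zero[OF mult_FI_closed[OF fg h]] by (simp add: mult_FI_closed zero)
  qed
qed

lemma mult_FI_r_distr:
  assumes f: "f \<in> carrier (FI P R)" and g: "g \<in> carrier (FI P R)" and h: "h \<in> carrier (FI P R)"
    and fg: "f \<oplus>\<^bsub>FI P R\<^esub> g \<in> carrier (FI P R)"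
  shows "h \<otimes>\<^bsub>FI P R\<^esub> (f \<oplus>\<^bsub>FI P R\<^esub> g) = h \<otimes>\<^bsub>FI P R\<^esub> f \<oplus>\<^bsub>FI P R\<^esub> h \<otimes>\<^bsub>FI P R\<^esub> g"
proof (intro ext)
  fix x y
  show "(h \<otimes>\<^bsub>FI P R\<^esub> (f \<oplus>\<^bsub>FI P R\<^esub> g)) x y = (h \<otimes>\<^bsub>FI P R\<^esub> f \<oplus>\<^bsub>FI P R\<^esub> h \<otimes>\<^bsub>FI P R\<^esub> g) x y"
  proof (cases "y \<in> carrier P")
    case True
    let ?T = "{z. z \<sqsubseteq>\<^bsub>P\<^esub> y \<and> h x z \<noteq> \<zero>}"
    have eq: "(h \<otimes>\<^bsub>FI P R\<^esub> k) x y = (\<Oplus>z\<in>?T. h x z \<otimes> k z y)" if "k \<in> carrier (FI P R)" for k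
      using finite_row[OF h True] by (rule mult_FI_eq_finsum[OF h that]) simp
    show ?thesis
      unfolding eq[OF fg] using f g h
      by (simp add: eq Pi_def r_distr)
  next
    case False
    then have zero: "k x y = \<zero>" if "k \<in> carrier (FI P R)" for k
      using FI_coeff_nonzero[OF that] by blast
    then show ?thesis
      using f g h zero[OF mult_FI_closed[OF h fg]] by (simp add: mult_FI_closed zero)
  qed
qed

lemma FI_add_closed:
  assumes "f \<in> carrier (FI P R)" "g \<in> carrier (FI P R)"
  shows "f \<oplus>\<^bsub>FI P R\<^esub> g \<in> carrier (FI P R)"
  using assms by (rule pointwise_closed) (use assms in auto)

lemma FI_smult_closed:
  assumes "r \<in> carrier R" "f \<in> carrier (FI P R)"
  shows "r \<odot>\<^bsub>FI P R\<^esub> f \<in> carrier (FI P R)"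
  using assms(2,2) by (rule pointwise_closed) (use assms in auto)

lemma abelian_group_FI: "abelian_group (FI P R)"
proof (rule abelian_groupI)
  fix f assume f: "f \<in> carrier (FI P R)"
  have "(\<lambda>x y. \<ominus> f x y) \<in> carrier (FI P R)"
    using f f by (rule pointwise_closed) (use f in auto)
  then show "\<exists>g\<in>carrier (FI P R). g \<oplus>\<^bsub>FI P R\<^esub> f = \<zero>\<^bsub>FI P R\<^esub>"
    by (rule bexI[rotated]) (use f in \<open>simp add: l_neg\<close>)
qed (use FI_add_closed FI_zero_closed in \<open>auto simp: a_ac\<close>)

lemma ring_FI: "ring (FI P R)"
proof (rule ringI[OF abelian_group_FI])
  show "monoid (FI P R)"
  proof (rule monoidI)
    fix f assume f: "f \<in> carrier (FI P R)"
    show "\<one>\<^bsub>FI P R\<^esub> \<otimes>\<^bsub>FI P R\<^esub> f = f"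
    proof (intro ext)
      fix x y
      have "(\<one>\<^bsub>FI P R\<^esub> \<otimes>\<^bsub>FI P R\<^esub> f) x y = \<one>\<^bsub>FI P R\<^esub> x x \<otimes> f x y"
        by (rule mult_FI_left_diagonal[OF FI_one_closed f]) (simp add: one_FI)
      also have "\<dots> = f x y"
        using f FI_coeff_nonzero[OF f, of x y]
        by (cases "f x y = \<zero>") (auto simp: one_FI)
      finally show "(\<one>\<^bsub>FI P R\<^esub> \<otimes>\<^bsub>FI P R\<^esub> f) x y = f x y" .
    qed
    show "f \<otimes>\<^bsub>FI P R\<^esub> \<one>\<^bsub>FI P R\<^esub> = f"
    proof (intro ext)
      fix x y
      have "(f \<otimes>\<^bsub>FI P R\<^esub> \<one>\<^bsub>FI P R\<^esub>) x y = f x y \<otimes> \<one>\<^bsub>FI P R\<^esub> y y"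
        by (rule mult_FI_right_diagonal[OF f FI_one_closed]) (simp add: one_FI)
      also have "\<dots> = f x y"
        using f FI_coeff_nonzero[OF f, of x y]
        by (cases "f x y = \<zero>") (auto simp: one_FI)
      finally show "(f \<otimes>\<^bsub>FI P R\<^esub> \<one>\<^bsub>FI P R\<^esub>) x y = f x y" .
    qed
  qed (use mult_FI_closed mult_FI_assoc FI_one_closed in auto)
qed (simp_all only: mult_FI_l_distr mult_FI_r_distr FI_add_closed)

sublocale FI: ring "FI P R"
  by (rule ring_FI)

subsection \<open>Matrix units\<close>

definition matrix_unit :: "'c \<Rightarrow> 'c \<Rightarrow> 'c \<Rightarrow> 'c \<Rightarrow> 'a" (\<open>\<e>\<close>)
  where "\<e> x y = (\<lambda>u v. if u = x \<and> v = y then \<one> else \<zero>)"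

lemma matrix_unit_coeff: "\<e> x y u v = (if u = x \<and> v = y then \<one> else \<zero>)"
  by (simp add: matrix_unit_def)

lemma matrix_unit_closed [simp, intro]:
  assumes "x \<in> carrier P" "y \<in> carrier P" "x \<sqsubseteq>\<^bsub>P\<^esub> y"
  shows "\<e> x y \<in> carrier (FI P R)"
proof (rule FI_I)
  show "finite {(u, v). a \<sqsubseteq>\<^bsub>P\<^esub> u \<and> u \<noteq> v \<and> v \<sqsubseteq>\<^bsub>P\<^esub> b \<and> \<e> x y u v \<noteq> \<zero>}" for a b
    by (rule finite_subset[of _ "{(x, y)}"]) (auto simp: matrix_unit_coeff split: if_splits)
qed (use assms in \<open>auto simp: matrix_unit_coeff split: if_splits\<close>)

lemma matrix_unit_mult:
  assumes "x \<in> carrier P" "y \<in> carrier P" "x \<sqsubseteq>\<^bsub>P\<^esub> y" "f \<in> carrier (FI P R)"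
  shows "(\<e> x y \<otimes>\<^bsub>FI P R\<^esub> f) u v = (if u = x then f y v else \<zero>)"
proof -
  have "(\<e> x y \<otimes>\<^bsub>FI P R\<^esub> f) u v = \<e> x y u y \<otimes> f y v"
    by (rule mult_FI_left_diagonal) (use assms in \<open>auto simp: matrix_unit_coeff\<close>)
  then show ?thesis
    using assms by (simp add: matrix_unit_coeff)
qed

lemma mult_matrix_unit:
  assumes "x \<in> carrier P" "y \<in> carrier P" "x \<sqsubseteq>\<^bsub>P\<^esub> y" "f \<in> carrier (FI P R)"
  shows "(f \<otimes>\<^bsub>FI P R\<^esub> \<e> x y) u v = (if v = y then f u x else \<zero>)"
proof -
  have "(f \<otimes>\<^bsub>FI P R\<^esub> \<e> x y) u v = f u x \<otimes> \<e> x y x v"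
    by (rule mult_FI_right_diagonal) (use assms in \<open>auto simp: matrix_unit_coeff\<close>)
  then show ?thesis
    using assms by (simp add: matrix_unit_coeff)
qed

lemma matrix_unit_mult_matrix_unit:
  assumes "x \<in> carrier P" "y \<in> carrier P" "x \<sqsubseteq>\<^bsub>P\<^esub> y"
    and "u \<in> carrier P" "v \<in> carrier P" "u \<sqsubseteq>\<^bsub>P\<^esub> v"
  shows "\<e> x y \<otimes>\<^bsub>FI P R\<^esub> \<e> u v = (if y = u then \<e> x v else \<zero>\<^bsub>FI P R\<^esub>)"
  by (intro ext, subst matrix_unit_mult) (use assms in \<open>auto simp: matrix_unit_coeff\<close>)

text \<open>Expresses a single coefficient through multiplication in the algebra, so that a
  derivation can be applied to it.\<close>

lemma peirce_corner:
  assumes "x \<in> carrier P" "y \<in> carrier P" "x \<sqsubseteq>\<^bsub>P\<^esub> y" "f \<in> carrier (FI P R)"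
  shows "\<e> x x \<otimes>\<^bsub>FI P R\<^esub> (f \<otimes>\<^bsub>FI P R\<^esub> \<e> y y) = f x y \<odot>\<^bsub>FI P R\<^esub> \<e> x y"
proof (intro ext)
  fix u v
  have "(\<e> x x \<otimes>\<^bsub>FI P R\<^esub> (f \<otimes>\<^bsub>FI P R\<^esub> \<e> y y)) u v =
      (if u = x then (f \<otimes>\<^bsub>FI P R\<^esub> \<e> y y) x v else \<zero>)"
    by (rule matrix_unit_mult) (use assms in auto)
  then show "(\<e> x x \<otimes>\<^bsub>FI P R\<^esub> (f \<otimes>\<^bsub>FI P R\<^esub> \<e> y y)) u v = (f x y \<odot>\<^bsub>FI P R\<^esub> \<e> x y) u v"
    using assms by (auto simp: mult_matrix_unit matrix_unit_coeff)
qed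

section \<open>Scalars, the algebra structure, and derivations at a single entry\<close>

lemma smult_FI_mult_left:
  assumes r: "r \<in> carrier R" and f: "f \<in> carrier (FI P R)" and g: "g \<in> carrier (FI P R)"
  shows "(r \<odot>\<^bsub>FI P R\<^esub> f) \<otimes>\<^bsub>FI P R\<^esub> g = r \<odot>\<^bsub>FI P R\<^esub> (f \<otimes>\<^bsub>FI P R\<^esub> g)"
proof (intro ext)
  fix x y
  show "((r \<odot>\<^bsub>FI P R\<^esub> f) \<otimes>\<^bsub>FI P R\<^esub> g) x y = (r \<odot>\<^bsub>FI P R\<^esub> (f \<otimes>\<^bsub>FI P R\<^esub> g)) x y"
  proof (cases "x \<in> carrier P")
    case True
    let ?T = "{z. x \<sqsubseteq>\<^bsub>P\<^esub> z \<and> g z y \<noteq> \<zero>}"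
    have fin: "finite ?T"
      using g True by (rule finite_column)
    have eq: "(k \<otimes>\<^bsub>FI P R\<^esub> g) x y = (\<Oplus>z\<in>?T. k x z \<otimes> g z y)" if "k \<in> carrier (FI P R)" for k
      by (rule mult_FI_eq_finsum[OF that g fin]) simp
    show ?thesis
      unfolding eq[OF FI_smult_closed[OF r f]] using r f g fin
      by (simp add: eq finsum_rdistr Pi_def m_assoc)
  next
    case False
    then have zero: "k x y = \<zero>" if "k \<in> carrier (FI P R)" for k
      using FI_coeff_nonzero[OF that] by blast
    show ?thesis
      using r f g zero[OF FI.m_closed[OF FI_smult_closed[OF r f] g]] by (simp add: zero)
  qed
qed

lemma smult_FI_mult_right:
  assumes r: "r \<in> carrier R" and f: "f \<in> carrier (FI P R)" and g: "g \<in> carrier (FI P R)"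
  shows "f \<otimes>\<^bsub>FI P R\<^esub> (r \<odot>\<^bsub>FI P R\<^esub> g) = r \<odot>\<^bsub>FI P R\<^esub> (f \<otimes>\<^bsub>FI P R\<^esub> g)"
proof (intro ext)
  fix x y
  show "(f \<otimes>\<^bsub>FI P R\<^esub> (r \<odot>\<^bsub>FI P R\<^esub> g)) x y = (r \<odot>\<^bsub>FI P R\<^esub> (f \<otimes>\<^bsub>FI P R\<^esub> g)) x y"
  proof (cases "x \<in> carrier P")
    case True
    let ?T = "{z. x \<sqsubseteq>\<^bsub>P\<^esub> z \<and> g z y \<noteq> \<zero>}"
    have fin: "finite ?T"
      using g True by (rule finite_column)
    have "(f \<otimes>\<^bsub>FI P R\<^esub> (r \<odot>\<^bsub>FI P R\<^esub> g)) x y = (\<Oplus>z\<in>?T. f x z \<otimes> (r \<otimes> g z y))"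
      by (subst mult_FI_eq_finsum[OF f FI_smult_closed[OF r g] fin]) (use r in auto)
    also have "\<dots> = r \<otimes> (\<Oplus>z\<in>?T. f x z \<otimes> g z y)"
      using r f g fin by (simp add: finsum_rdistr Pi_def m_lcomm)
    also have "(\<Oplus>z\<in>?T. f x z \<otimes> g z y) = (f \<otimes>\<^bsub>FI P R\<^esub> g) x y"
      by (rule mult_FI_eq_finsum[OF f g fin, symmetric]) simp
    finally show ?thesis
      by simp
  next
    case False
    then have zero: "k x y = \<zero>" if "k \<in> carrier (FI P R)" for k
      using FI_coeff_nonzero[OF that] by blast
    show ?thesis
      using r f g zero[OF FI.m_closed[OF f FI_smult_closed[OF r g]]] by (simp add: zero)
  qed
qed

lemma assoc_algebra_FI: "assoc_algebra R (FI P R)"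
proof -
  have "module R (FI P R)"
    by (rule moduleI[OF R.is_cring abelian_group_FI FI_smult_closed])
      (auto simp: l_distr r_distr m_assoc)
  then show ?thesis
    using ring_FI smult_FI_mult_left smult_FI_mult_right
    by (auto intro!: assoc_algebra.intro assoc_algebra_axioms.intro simp del: smult_FI)
qed

text \<open>Apply \<open>D\<close> to \<open>peirce_corner\<close> and compare the entries at (x,
  y). Linearity makes one side f(x, y) times an entry of \<open>D (\<e> x y)\<close>, which is zero.
  On the other side the Leibniz rule leaves D(f)(x, y) plus two convolutions, which only involve row
  x of \<open>D (\<e> x x)\<close> and column y of \<open>D (\<e> y y)\<close> between x and y. Thus
  no decomposition of f into infinitely many matrix units enters.\<close>

lemma derivation_coeff_eq_zero:
  assumes D_closed: "\<And>f. f \<in> carrier (FI P R) \<Longrightarrow> D f \<in> carrier (FI P R)"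
    and D_mult: "\<And>f g. \<lbrakk>f \<in> carrier (FI P R); g \<in> carrier (FI P R)\<rbrakk> \<Longrightarrow>
      D (f \<otimes>\<^bsub>FI P R\<^esub> g) = D f \<otimes>\<^bsub>FI P R\<^esub> g \<oplus>\<^bsub>FI P R\<^esub> f \<otimes>\<^bsub>FI P R\<^esub> D g"
    and D_smult: "\<And>r f. \<lbrakk>r \<in> carrier R; f \<in> carrier (FI P R)\<rbrakk> \<Longrightarrow>
      D (r \<odot>\<^bsub>FI P R\<^esub> f) = r \<odot>\<^bsub>FI P R\<^esub> D f"
    and x: "x \<in> carrier P" and y: "y \<in> carrier P" and xy: "x \<sqsubseteq>\<^bsub>P\<^esub> y"
    and row: "\<And>t. \<lbrakk>t \<in> carrier P; x \<sqsubseteq>\<^bsub>P\<^esub> t; t \<sqsubset>\<^bsub>P\<^esub> y\<rbrakk> \<Longrightarrow> D (\<e> x x) x t = \<zero>"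
    and col: "\<And>t. \<lbrakk>t \<in> carrier P; x \<sqsubset>\<^bsub>P\<^esub> t; t \<sqsubseteq>\<^bsub>P\<^esub> y\<rbrakk> \<Longrightarrow> D (\<e> y y) t y = \<zero>"
    and corner: "D (\<e> x x) x y = \<zero>" "D (\<e> x y) x y = \<zero>" "D (\<e> y y) x y = \<zero>"
    and f: "f \<in> carrier (FI P R)"
  shows "D f x y = \<zero>"
proof -
  note closed = D_closed f x y xy P.le_refl matrix_unit_closed FI.m_closed FI_coeff_closed
  have "D (\<e> x x \<otimes>\<^bsub>FI P R\<^esub> (f \<otimes>\<^bsub>FI P R\<^esub> \<e> y y)) = f x y \<odot>\<^bsub>FI P R\<^esub> D (\<e> x y)"
    unfolding peirce_corner[OF x y xy f] by (rule D_smult) (use closed in auto)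
  then have "D (\<e> x x \<otimes>\<^bsub>FI P R\<^esub> (f \<otimes>\<^bsub>FI P R\<^esub> \<e> y y)) x y = \<zero>"
    using corner f by simp
  moreover have "D (\<e> x x \<otimes>\<^bsub>FI P R\<^esub> (f \<otimes>\<^bsub>FI P R\<^esub> \<e> y y)) x y =
      (D (\<e> x x) \<otimes>\<^bsub>FI P R\<^esub> (f \<otimes>\<^bsub>FI P R\<^esub> \<e> y y)) x y \<oplus> D (f \<otimes>\<^bsub>FI P R\<^esub> \<e> y y) x y"
    using closed by (simp add: D_mult[of "\<e> x x"] matrix_unit_mult)
  moreover have "(D (\<e> x x) \<otimes>\<^bsub>FI P R\<^esub> (f \<otimes>\<^bsub>FI P R\<^esub> \<e> y y)) x y = \<zero>"
  proof (rule mult_FI_eq_zero)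
    fix t assume t: "t \<in> carrier P" "x \<sqsubseteq>\<^bsub>P\<^esub> t" "t \<sqsubseteq>\<^bsub>P\<^esub> y"
    \<comment> \<open>The hypothesis \<open>row\<close> covers t < y; the endpoint t = y is the
      first corner condition.\<close>
    have "D (\<e> x x) x t = \<zero>"
      using row[OF t(1,2)] corner(1) t(3) by (cases "t = y") (auto simp: P.lless_eq)
    then show "D (\<e> x x) x t \<otimes> (f \<otimes>\<^bsub>FI P R\<^esub> \<e> y y) t y = \<zero>"
      using closed by simp
  qed
  moreover have "D (f \<otimes>\<^bsub>FI P R\<^esub> \<e> y y) x y = D f x y \<oplus> (f \<otimes>\<^bsub>FI P R\<^esub> D (\<e> y y)) x y"
    using closed by (simp add: D_mult mult_matrix_unit)
  moreover have "(f \<otimes>\<^bsub>FI P R\<^esub> D (\<e> y y)) x y = \<zero>"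
  proof (rule mult_FI_eq_zero)
    fix t assume t: "t \<in> carrier P" "x \<sqsubseteq>\<^bsub>P\<^esub> t" "t \<sqsubseteq>\<^bsub>P\<^esub> y"
    have "D (\<e> y y) t y = \<zero>"
      using col[OF t(1) _ t(3)] corner(3) t(2) by (cases "t = x") (auto simp: P.lless_eq)
    then show "f x t \<otimes> D (\<e> y y) t y = \<zero>"
      using closed by simp
  qed
  ultimately show ?thesis
    using closed by simp
qed

end

section \<open>The Jacobi identity\<close>

locale finitary_incidence_biderivation = finitary_incidence R P +
  biderivation: antisymmetric_biderivation "FI P R" B
  for R (structure) and P (structure) and B +
  assumes bilinear: "bilinear_op R (FI P R) B"
begin

abbreviation "J \<equiv> biderivation.jacobiator"

section \<open>Values of \<open>B\<close> on matrix units\<close>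

lemma B_smult_left: "\<lbrakk>r \<in> carrier R; f \<in> carrier (FI P R); g \<in> carrier (FI P R)\<rbrakk> \<Longrightarrow>
      B (r \<odot>\<^bsub>FI P R\<^esub> f) g = r \<odot>\<^bsub>FI P R\<^esub> B f g"
  and B_smult_right: "\<lbrakk>r \<in> carrier R; f \<in> carrier (FI P R); g \<in> carrier (FI P R)\<rbrakk> \<Longrightarrow>
      B f (r \<odot>\<^bsub>FI P R\<^esub> g) = r \<odot>\<^bsub>FI P R\<^esub> B f g"
  using bilinear unfolding bilinear_op_def by blast+

lemma J_smult:
  assumes "r \<in> carrier R" "f \<in> carrier (FI P R)" "g \<in> carrier (FI P R)" "h \<in> carrier (FI P R)"
  shows "J f g (r \<odot>\<^bsub>FI P R\<^esub> h) = r \<odot>\<^bsub>FI P R\<^esub> J f g h"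
  unfolding biderivation.jacobiator_def using assms
  by (simp add: B_smult_left B_smult_right del: smult_FI add_FI) (simp add: r_distr)

text \<open>The derivation B(f, -) kills both diagonal units, so it commutes with multiplication by
  them and maps the corner spanned by \<open>\<e> x y\<close> into itself.\<close>

lemma B_matrix_unit:
  assumes x: "x \<in> carrier P" and y: "y \<in> carrier P" and xy: "x \<sqsubseteq>\<^bsub>P\<^esub> y"
    and f: "f \<in> carrier (FI P R)"
    and zero: "B f (\<e> x x) = \<zero>\<^bsub>FI P R\<^esub>" "B f (\<e> y y) = \<zero>\<^bsub>FI P R\<^esub>"
  shows "B f (\<e> x y) = B f (\<e> x y) x y \<odot>\<^bsub>FI P R\<^esub> \<e> x y"
proof -
  note closed = x y xy f P.le_refl matrix_unit_closed
  have "\<e> x y = \<e> x x \<otimes>\<^bsub>FI P R\<^esub> (\<e> x y \<otimes>\<^bsub>FI P R\<^esub> \<e> y y)"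
    using closed by (simp add: matrix_unit_mult_matrix_unit)
  then have "B f (\<e> x y) = B f (\<e> x x \<otimes>\<^bsub>FI P R\<^esub> (\<e> x y \<otimes>\<^bsub>FI P R\<^esub> \<e> y y))"
    by (rule arg_cong)
  also have "\<dots> = \<e> x x \<otimes>\<^bsub>FI P R\<^esub> (B f (\<e> x y) \<otimes>\<^bsub>FI P R\<^esub> \<e> y y)"
    using closed by (simp add: biderivation.B_mult_right zero del: zero_FI add_FI)
  also have "\<dots> = B f (\<e> x y) x y \<odot>\<^bsub>FI P R\<^esub> \<e> x y"
    by (rule peirce_corner) (use closed in auto)
  finally show ?thesis .
qed

text \<open>Diagonal units are idempotents that commute with each other, whether x and y are equal
  or not.\<close>

lemma B_diagonal_units:
  assumes "x \<in> carrier P" "y \<in> carrier P"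
  shows "B (\<e> x x) (\<e> y y) = \<zero>\<^bsub>FI P R\<^esub>"
  by (rule biderivation.B_commuting_idempotent)
    (use assms in \<open>auto simp: matrix_unit_mult_matrix_unit simp del: zero_FI\<close>)

section \<open>Vanishing of the entries of the Jacobiator\<close>

lemma matrix_unit_eq_commutator:
  assumes "x \<in> carrier P" "y \<in> carrier P" "x \<sqsubset>\<^bsub>P\<^esub> y"
  shows "\<e> x y = \<e> x x \<otimes>\<^bsub>FI P R\<^esub> \<e> x y \<ominus>\<^bsub>FI P R\<^esub> \<e> x y \<otimes>\<^bsub>FI P R\<^esub> \<e> x x"
proof -
  have "x \<sqsubseteq>\<^bsub>P\<^esub> y" "y \<noteq> x"
    using assms(3) by (auto simp: P.lless_eq)
  then show ?thesis
    using assms(1,2)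
    by (simp add: matrix_unit_mult_matrix_unit FI.minus_eq del: zero_FI add_FI)
qed

lemma J_coeff_below:
  assumes x: "x \<in> carrier P" and y: "y \<in> carrier P" and "x \<sqsubset>\<^bsub>P\<^esub> y"
    and "f \<in> carrier (FI P R)" "g \<in> carrier (FI P R)" "h \<in> carrier (FI P R)"
  shows "J f g h u x = \<zero>" "J f g h y u = \<zero>"
proof -
  have xy: "x \<sqsubseteq>\<^bsub>P\<^esub> y"
    using assms(3) by (rule lless_imp_le)
  note closed = x y xy assms(4-6) P.le_refl matrix_unit_closed FI_smult_closed FI_coeff_closed
    biderivation.B_closed biderivation.jacobiator_closed
  define c where "c = B (\<e> x x) (\<e> x y) x y"
  have c: "c \<in> carrier R"
    unfolding c_def using closed by auto
  have B: "B (\<e> x x) (\<e> x y) = c \<odot>\<^bsub>FI P R\<^esub> \<e> x y"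
    unfolding c_def by (rule B_matrix_unit) (use closed in \<open>auto simp: B_diagonal_units\<close>)
  note comm = matrix_unit_eq_commutator[OF x y assms(3)]
  have "J f g h \<otimes>\<^bsub>FI P R\<^esub> (\<e> x x \<otimes>\<^bsub>FI P R\<^esub> \<e> x y \<ominus>\<^bsub>FI P R\<^esub> \<e> x y \<otimes>\<^bsub>FI P R\<^esub> \<e> x x) = \<zero>\<^bsub>FI P R\<^esub>"
  proof (rule biderivation.jacobiator_mult_commutator)
    \<comment> \<open>The factor q is chosen as c times the left identity \<open>\<e> x x\<close> of
      \<open>\<e> x y\<close>; the mirrored case below uses its right identity
      \<open>\<e> y y\<close>.\<close>
    show "c \<odot>\<^bsub>FI P R\<^esub> \<e> x x \<in> carrier (FI P R)"
      using closed c by blast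
    show "B (\<e> x x) (\<e> x y) = (c \<odot>\<^bsub>FI P R\<^esub> \<e> x x) \<otimes>\<^bsub>FI P R\<^esub>
        (\<e> x x \<otimes>\<^bsub>FI P R\<^esub> \<e> x y \<ominus>\<^bsub>FI P R\<^esub> \<e> x y \<otimes>\<^bsub>FI P R\<^esub> \<e> x x)"
      unfolding comm[symmetric] B using closed c
      by (simp add: smult_FI_mult_left matrix_unit_mult_matrix_unit del: smult_FI)
  qed (use closed in blast)+
  then have "(J f g h \<otimes>\<^bsub>FI P R\<^esub> \<e> x y) u y = \<zero>"
    unfolding comm[symmetric] by simp
  then show "J f g h u x = \<zero>"
    using closed by (simp add: mult_matrix_unit)
  have "(\<e> x x \<otimes>\<^bsub>FI P R\<^esub> \<e> x y \<ominus>\<^bsub>FI P R\<^esub> \<e> x y \<otimes>\<^bsub>FI P R\<^esub> \<e> x x) \<otimes>\<^bsub>FI P R\<^esub> J f g h = \<zero>\<^bsub>FI P R\<^esub>"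
  proof (rule biderivation.commutator_mult_jacobiator)
    show "c \<odot>\<^bsub>FI P R\<^esub> \<e> y y \<in> carrier (FI P R)"
      using closed c by blast
    show "B (\<e> x x) (\<e> x y) =
        (\<e> x x \<otimes>\<^bsub>FI P R\<^esub> \<e> x y \<ominus>\<^bsub>FI P R\<^esub> \<e> x y \<otimes>\<^bsub>FI P R\<^esub> \<e> x x) \<otimes>\<^bsub>FI P R\<^esub> (c \<odot>\<^bsub>FI P R\<^esub> \<e> y y)"
      unfolding comm[symmetric] B using closed c
      by (simp add: smult_FI_mult_right matrix_unit_mult_matrix_unit del: smult_FI)
  qed (use closed in blast)+
  then have "(\<e> x y \<otimes>\<^bsub>FI P R\<^esub> J f g h) x u = \<zero>"
    unfolding comm[symmetric] by simp
  then show "J f g h y u = \<zero>"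
    using closed by (simp add: matrix_unit_mult)
qed

text \<open>Bracketing with \<open>\<e> x x\<close> and \<open>\<e> y y\<close> multiplies
  \<open>\<e> x y\<close> by the scalars c and d. These commute, so the first two terms of the
  Jacobiator cancel; the third contains B of two diagonal units, which is zero.\<close>

lemma J_matrix_units:
  assumes x: "x \<in> carrier P" and y: "y \<in> carrier P" and xy: "x \<sqsubseteq>\<^bsub>P\<^esub> y"
  shows "J (\<e> x x) (\<e> y y) (\<e> x y) = \<zero>\<^bsub>FI P R\<^esub>"
proof -
  note closed = x y xy P.le_refl matrix_unit_closed FI_smult_closed FI_coeff_closed
    biderivation.B_closed
  define c where "c = B (\<e> x x) (\<e> x y) x y"
  define d where "d = B (\<e> y y) (\<e> x y) x y"
  have cd: "c \<in> carrier R" "d \<in> carrier R"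
    unfolding c_def d_def using closed by auto
  have B: "B (\<e> x x) (\<e> x y) = c \<odot>\<^bsub>FI P R\<^esub> \<e> x y" "B (\<e> y y) (\<e> x y) = d \<odot>\<^bsub>FI P R\<^esub> \<e> x y"
    unfolding c_def d_def by (rule B_matrix_unit; use closed in \<open>auto simp: B_diagonal_units\<close>)+
  have 1: "B (\<e> x x) (B (\<e> y y) (\<e> x y)) = d \<odot>\<^bsub>FI P R\<^esub> (c \<odot>\<^bsub>FI P R\<^esub> \<e> x y)"
    using closed cd by (simp add: B B_smult_right del: smult_FI)
  have "B (\<e> y y) (B (\<e> x y) (\<e> x x)) = \<ominus>\<^bsub>FI P R\<^esub> (c \<odot>\<^bsub>FI P R\<^esub> (d \<odot>\<^bsub>FI P R\<^esub> \<e> x y))"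
    using closed cd
    by (simp add: biderivation.B_skew[of "\<e> x x" "\<e> x y"] biderivation.B_minus_right B B_smult_right
        del: smult_FI)
  also have "c \<odot>\<^bsub>FI P R\<^esub> (d \<odot>\<^bsub>FI P R\<^esub> \<e> x y) = d \<odot>\<^bsub>FI P R\<^esub> (c \<odot>\<^bsub>FI P R\<^esub> \<e> x y)"
    using closed cd by (simp add: m_lcomm)
  finally show ?thesis
    unfolding biderivation.jacobiator_def 1 using closed cd
    by (simp add: B_diagonal_units biderivation.B_zero_right FI.r_neg FI.r_zero
        del: smult_FI add_FI zero_FI)
qed

text \<open>At a fixed entry (x, y) the Jacobiator vanishes when all arguments are in
  \<open>S\<close>. The restriction to \<open>S\<close> is then lifted from one argument at a time,
  cyclic symmetry bringing that argument into the last place.\<close>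

lemma J_eq_zero:
  assumes f: "f \<in> carrier (FI P R)" and g: "g \<in> carrier (FI P R)" and h: "h \<in> carrier (FI P R)"
  shows "J f g h = \<zero>\<^bsub>FI P R\<^esub>"
proof (intro ext)
  fix x y
  have "J f g h x y = \<zero>" if x: "x \<in> carrier P" and y: "y \<in> carrier P" and xy: "x \<sqsubseteq>\<^bsub>P\<^esub> y"
  proof -
    define S where "S = {\<e> x x, \<e> y y, \<e> x y}"
    have S: "S \<subseteq> carrier (FI P R)"
      unfolding S_def using x y xy by auto
    have units: "J a b c = \<zero>\<^bsub>FI P R\<^esub>" if "a \<in> S" "b \<in> S" "c \<in> S" for a b c
    proof -
      have self: "J a a b = \<zero>\<^bsub>FI P R\<^esub>" "J a b a = \<zero>\<^bsub>FI P R\<^esub>" "J b a a = \<zero>\<^bsub>FI P R\<^esub>"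
        if "a \<in> carrier (FI P R)" "b \<in> carrier (FI P R)" for a b
        using biderivation.jacobiator_self[OF that] biderivation.jacobiator_cyclic[OF that(1) that]
          biderivation.jacobiator_cyclic[OF that that(1)] by simp_all
      have mem: "\<e> x x \<in> carrier (FI P R)" "\<e> y y \<in> carrier (FI P R)" "\<e> x y \<in> carrier (FI P R)"
        using x y xy by auto
      \<comment> \<open>Of the 27 choices from \<open>S\<close>, those with a repetition fall under
        \<open>self\<close>; \<open>even\<close> and \<open>odd\<close> list the six arrangements of
        the three units.\<close>
      note even = J_matrix_units[OF x y xy]
        J_matrix_units[OF x y xy, unfolded biderivation.jacobiator_cyclic[OF mem]]
        J_matrix_units[OF x y xy, folded biderivation.jacobiator_cyclic[OF mem(3,1,2)]]
      have "J (\<e> y y) (\<e> x x) (\<e> x y) = \<zero>\<^bsub>FI P R\<^esub>"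
        using biderivation.jacobiator_skew[OF mem] even(1) FI.minus_zero by simp
      note odd = this
        this[unfolded biderivation.jacobiator_cyclic[OF mem(2,1,3)]]
        this[folded biderivation.jacobiator_cyclic[OF mem(3,2,1)]]
      have "a \<in> {\<e> x x, \<e> y y, \<e> x y}" "b \<in> {\<e> x x, \<e> y y, \<e> x y}" "c \<in> {\<e> x x, \<e> y y, \<e> x y}"
        using that unfolding S_def by auto
      then show ?thesis
        by (elim insertE emptyE) (simp_all only: self mem even odd)
    qed
    have extend: "J a b c x y = \<zero>"
      if a: "a \<in> carrier (FI P R)" and b: "b \<in> carrier (FI P R)" and c: "c \<in> carrier (FI P R)"
        and "\<And>s. s \<in> S \<Longrightarrow> J a b s x y = \<zero>" for a b c
    proof (rule derivation_coeff_eq_zero[where D = "J a b", OF _ _ _ x y xy])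
      \<comment> \<open>Since t < y, column t is not at a maximal element, and
        \<open>J_coeff_below\<close> applies; dually row t is not at a minimal one when x <
        t.\<close>
      fix t assume "t \<in> carrier P" "t \<sqsubset>\<^bsub>P\<^esub> y"
      then show "J a b (\<e> x x) x t = \<zero>"
        using J_coeff_below(1)[of t y a b] x y a b by auto
    next
      fix t assume "t \<in> carrier P" "x \<sqsubset>\<^bsub>P\<^esub> t"
      then show "J a b (\<e> y y) t y = \<zero>"
        using J_coeff_below(2)[of x t a b] x y a b by auto
    qed (use a b c that(4) in \<open>auto simp: S_def biderivation.jacobiator_mult J_smult
        simp del: add_FI smult_FI\<close>)
    have 1: "J a b c x y = \<zero>" if "a \<in> S" "b \<in> S" "c \<in> carrier (FI P R)" for a b c
      by (rule extend) (use that S units in auto)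
    have 2: "J a b c x y = \<zero>" if "a \<in> S" "b \<in> carrier (FI P R)" "c \<in> carrier (FI P R)" for a b c
    proof -
      \<comment> \<open>The second argument b is rotated to the end; for s in \<open>S\<close> in
        its place, J(c, a, s) = J(a, s, c), which is covered by \<open>1\<close>.\<close>
      have "J c a b x y = \<zero>"
      proof (rule extend)
        fix s assume s: "s \<in> S"
        show "J c a s x y = \<zero>"
          using 1[OF that(1) s that(3)]
            biderivation.jacobiator_cyclic[OF that(3) subsetD[OF S that(1)] subsetD[OF S s]]
          by simp
      qed (use that S in auto)
      then show ?thesis
        using biderivation.jacobiator_cyclic[OF that(3) subsetD[OF S that(1)] that(2)] by simp
    qed
    show ?thesis
    proof (rule extend[OF f g h])
      fix s assume s: "s \<in> S"
      show "J f g s x y = \<zero>"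
        using 2[OF s f g] biderivation.jacobiator_cyclic[OF subsetD[OF S s] f g] by simp
    qed
  qed
  \<comment> \<open>Membership in the algebra settles the entries at pairs that do not satisfy x
    \<le> y in P.\<close>
  moreover have "J f g h \<in> carrier (FI P R)"
    using assms by (rule biderivation.jacobiator_closed)
  ultimately show "J f g h x y = \<zero>\<^bsub>FI P R\<^esub> x y"
    using FI_coeff_nonzero[of "J f g h" x y] by auto
qed

end

theorem corollary4p2:
  fixes P :: "('p, 'q) gorder_scheme"
    and R :: "('r, 'k) ring_scheme"
    and B :: "('p \<Rightarrow> 'p \<Rightarrow> 'r) \<Rightarrow> ('p \<Rightarrow> 'p \<Rightarrow> 'r) \<Rightarrow> ('p \<Rightarrow> 'p \<Rightarrow> 'r)"
  assumes "partial_order P"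
    and "cring R"
    and "bilinear_op R (FI P R) B"
    and "antisymmetric_op (FI P R) B"
    and "biderivation (FI P R) B"
  shows "poisson_structure R (FI P R) B"
proof -
  interpret finitary_incidence R P
    using assms(1,2) by (simp add: finitary_incidence_def)
  interpret finitary_incidence_biderivation R P B
    by unfold_locales (use assms in auto)
  interpret A: assoc_algebra R "FI P R"
    by (rule assoc_algebra_FI)
  show ?thesis
  proof unfold_locales
    fix a b c
    assume "a \<in> carrier (FI P R)" "b \<in> carrier (FI P R)" "c \<in> carrier (FI P R)"
    then show "B a (B b c) \<oplus>\<^bsub>FI P R\<^esub> B b (B c a) \<oplus>\<^bsub>FI P R\<^esub> B c (B a b) = \<zero>\<^bsub>FI P R\<^esub>"
      using J_eq_zero unfolding biderivation.jacobiator_def by blast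
  qed (use assms(3) biderivation.B_self biderivation.B_mult_right in blast)+
qed

end
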